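(* Let $\mathcal{J}\subset\{1,\ldots,d\}$ be a set of active variables, with vector of subdivisions $\boldsymbol{S}=(\boldsymbol{S}_i;\, i\in\mathcal{J})$, where $\boldsymbol{S}_i$ has $m_i$ knots $0=t^{(\boldsymbol{S}_i)}_{(1)}<\cdots<t^{(\boldsymbol{S}_i)}_{(m_i)}=1$ and hat basis functions $\phi_{i,1},\ldots,\phi_{i,m_i}$. Let $$\widehat{Y}_{\boldsymbol{S}}(\boldsymbol{x})=\sum_{i\in\mathcal{J}}\sum_{j=1}^{m_i}\widehat{\xi}_{i,j}\,\phi_{i,j}(x_i)$$ be the mode function of the additive constrained Gaussian process model with active set $\mathcal{J}$ and subdivisions $\boldsymbol{S}$. Let $i^\star\in\{1,\ldots,d\}\setminus\mathcal{J}$, and let $$\widehat{Y}_{\boldsymbol{S},i^\star}(\boldsymbol{x})=\sum_{i\in\mathcal{J}}\sum_{j=1}^{m_i}\widetilde{\xi}_{i,j}\,\phi_{i,j}(x_i)+\sum_{j=1}^{2}\widetilde{\xi}_{i^\star,j}\,\phi_{i^\star,j}(x_{i^\star}),\qquad \phi_{i^\star,1}(u)=1-u,\quad \phi_{i^\star,2}(u)=u \quad (u\in[0,1]),$$ be the mode function of the model with active set $\mathcal{J}\cup\{i^\star\}$, with subdivisions $\boldsymbol{S}_i$ for $i\in\mathcal{J}$ and $\boldsymbol{S}_{i^\star}=\{0,1\}$. Define $$I_{\boldsymbol{S},i^\star}=\int_{[0,1]^{|\mathcal{J}|+1}}\left(\widehat{Y}_{\boldsymbol{S}}(\boldsymbol{x})-\widehat{Y}_{\boldsymbol{S},i^\star}(\boldsymbol{x})\right)^2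 d\boldsymbol{x},$$ where $\boldsymbol{x}=(x_i;\, i\in\mathcal{J}\cup\{i^\star\})$ and $\widehat{Y}_{\boldsymbol{S}}$ is seen as a function of $|\mathcal{J}|+1$ variables that does not depend on $x_{i^\star}$. Then $$I_{\boldsymbol{S},i^\star}=\sum_{i\in\mathcal{J}}\ \sum_{\substack{j,j'=1\\ |j-j'|\le 1}}^{m_i}\eta_{i,j}\,\eta_{i,j'}\,E^{(\boldsymbol{S}_i)}_{j,j'}-\sum_{i\in\mathcal{J}}\Big(\sum_{j=1}^{m_i}\eta_{i,j}E^{(\boldsymbol{S}_i)}_{j}\Big)^2+\frac{\eta_{i^\star}^2}{12}+\Big(\sum_{i\in\mathcal{J}}\sum_{j=1}^{m_i}\eta_{i,j}E^{(\boldsymbol{S}_i)}_{j}-\frac{\zeta_{i^\star}}{2}\Big)^2,$$ where $\eta_{i,j}=\widehat{\xi}_{i,j}-\widetilde{\xi}_{i,j}$, $\eta_{i^\star}=\widetilde{\xi}_{i^\star,2}-\widetilde{\xi}_{i^\star,1}$, $\zeta_{i^\star}=\widetilde{\xi}_{i^\star,1}+\widetilde{\xi}_{i^\star,2}$, and where $E^{(\boldsymbol{S}_i)}_{j}:=\int_0^1\phi_{i,j}(t)\,dt$ and $E^{(\boldsymbol{S}_i)}_{j,j'}:=\int_0^1\phi_{i,j}(t)\phi_{i,j'}(t)\,dt$ have the following explicit expressions, writing $u_{(j)}=t^{(\boldsymbol{S}_i)}_{(j)}$ and $m_i$ for the number of knots: $$E^{(\boldsymbol{S}_i)}_{j}=\begin{cases}\frac{u_{(2)}}{2}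 & j=1,\\[2pt] \frac{1-u_{(m_i-1)}}{2} & j=m_i,\\[2pt] \frac{u_{(j+1)}-u_{(j-1)}}{2} & 2\le j\le m_i-1,\end{cases} \qquad E^{(\boldsymbol{S}_i)}_{j,j'}=\begin{cases}\frac{u_{(2)}-u_{(1)}}{3} & j=j'=1,\\[2pt] \frac{u_{(m_i)}-u_{(m_i-1)}}{3} & j=j'=m_i,\\[2pt] \frac{u_{(j+1)}-u_{(j-1)}}{3} & j=j'\in\{2,\ldots,m_i-1\},\\[2pt] \frac{u_{(j+1)}-u_{(j)}}{6} & j'=j+1,\\[2pt] \frac{u_{(j)}-u_{(j-1)}}{6} & j'=j-1,\\[2pt] 0 & |j-j'|\ge 2.\end{cases}$$ In particular the matrices $(E^{(\boldsymbol{S}_i)}_{j,j'})_{1\le j,j'\le m_i}$ are 1-band (zero whenever $|j-j'|\geq 2$), and the computational cost of evaluating this expression of $I_{\boldsymbol{S},i^\star}$ (given the knots and the coefficients $\widehat{\xi}_{i,j}$, $\widetilde{\xi}_{i,j}$, $\widetilde{\xi}_{i^\star,j}$) is linear with respect to $m=\sum_{i\in\mathcal{J}}m_i$.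
   Context: Subdivisions and hat functions. A subdivision $\boldsymbol{S}_i$ is a finite subset of $[0,1]$ containing $0$ and $1$; its elements are called knots and are ordered as $0=t^{(\boldsymbol{S}_i)}_{(1)}<\cdots<t^{(\boldsymbol{S}_i)}_{(m_i)}=1$ (so $m_i\ge 2$), with the conventions $t^{(\boldsymbol{S}_i)}_{(0)}=-1$, $t^{(\boldsymbol{S}_i)}_{(m_i+1)}=2$. For $u<v<w$ let $\phi_{u,v,w}(t)=\frac{t-u}{v-u}$ for $u\le t\le v$, $\frac{w-t}{w-v}$ for $v\le t\le w$, and $0$ for $t\notin[u,w]$. The hat basis functions of $\boldsymbol{S}_i$ are $\phi_{i,j}=\phi_{t^{(\boldsymbol{S}_i)}_{(j-1)},t^{(\boldsymbol{S}_i)}_{(j)},t^{(\boldsymbol{S}_i)}_{(j+1)}}$ restricted to $[0,1]$, $j=1,\ldots,m_i$. Mode function. Fix data $\boldsymbol{x}_1,\ldots,\boldsymbol{x}_n\in[0,1]^d$, $\boldsymbol{y}_n\in\mathbb{R}^n$ and a noise variance $\tau^2>0$. For each variable $i$ let $k_i$ be a covariance function on $[0,1]$ (its parameters may be re-estimated for each model). Given an active set $A\subseteq\{1,\ldots,d\}$ and subdivisions $(\boldsymbol{S}_i)_{i\in A}$, let $\boldsymbol{\Sigma}_i=(k_i(t^{(\boldsymbol{S}_i)}_{(a)},t^{(\boldsymbol{S}_i)}_{(b)}))_{a,b}$ be the $m_i\times m_i$ covariance matrix at the knots, and let $\boldsymbol{\Phi}_i$ be the $n\times m_i$ matrix whose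 $(a,b)$ entry is $\phi_{i,b}$ evaluated at the $i$-th coordinate of $\boldsymbol{x}_a$. Let $\boldsymbol{C}=\sum_{p\in A}\boldsymbol{\Phi}_p\boldsymbol{\Sigma}_p\boldsymbol{\Phi}_p^\top+\tau^2\boldsymbol{I}_n$, let $\boldsymbol{\mu}_c$ be the block vector with blocks $\boldsymbol{\mu}_{c,i}=\boldsymbol{\Sigma}_i\boldsymbol{\Phi}_i^\top\boldsymbol{C}^{-1}\boldsymbol{y}_n$, and let $\boldsymbol{\Sigma}_c$ be the block matrix with blocks $\boldsymbol{\Sigma}_{c,i,j}=\mathbf{1}_{i=j}\boldsymbol{\Sigma}_i-\boldsymbol{\Sigma}_i\boldsymbol{\Phi}_i^\top\boldsymbol{C}^{-1}\boldsymbol{\Phi}_j\boldsymbol{\Sigma}_j$ ($i,j\in A$), assumed invertible. Each variable $i$ carries linear inequality constraints on the values at its knots, $\boldsymbol{l}_i\le\boldsymbol{\Lambda}_i\boldsymbol{c}_i\le\boldsymbol{u}_i$, $\boldsymbol{c}_i\in\mathbb{R}^{m_i}$, with $\boldsymbol{\Lambda}_i,\boldsymbol{l}_i,\boldsymbol{u}_i$ depending on the subdivision $\boldsymbol{S}_i$ (for example $c_{i,j}-c_{i,j-1}\ge0$ for all $j\ge 2$, encoding monotonicity); the constraints are feasible. The coefficients of the mode are $$\widehat{\boldsymbol{\xi}}=\underset{\boldsymbol{c}=(\boldsymbol{c}_i)_{i\in A}:\ \boldsymbol{l}_i\le\boldsymbol{\Lambda}_i\boldsymbol{c}_i\le\boldsymbol{u}_i,\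 i\in A}{\mathrm{argmin}}(\boldsymbol{c}-\boldsymbol{\mu}_c)^\top\boldsymbol{\Sigma}_c^{-1}(\boldsymbol{c}-\boldsymbol{\mu}_c),$$ and the mode function of the model is $\boldsymbol{x}\mapsto\sum_{i\in A}\sum_{j=1}^{m_i}\widehat{\xi}_{i,j}\phi_{i,j}(x_i)$ on $[0,1]^{|A|}$. In the claim, $\widehat{\xi}$ denotes the coefficients obtained for the active set $\mathcal{J}$, and $\widetilde{\xi}$ those obtained for the active set $\mathcal{J}\cup\{i^\star\}$ with $\boldsymbol{S}_{i^\star}=\{0,1\}$; in general $\widehat{\xi}_{i,j}\ne\widetilde{\xi}_{i,j}$ for $i\in\mathcal{J}$. *)

theory Defs
  imports
    "HOL-Analysis.Analysis"
    "Jordan_Normal_Form.Matrix"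
    "Jordan_Normal_Form.Gauss_Jordan_Elimination"
begin

section \<open>Subdivisions and hat functions\<close>

definition subdivision :: "real set \<Rightarrow> bool" where
  "subdivision S \<longleftrightarrow> finite S \<and> S \<subseteq> {0..1} \<and> 0 \<in> S \<and> 1 \<in> S"

text \<open>Knots are numbered from 1 to \<open>card S\<close>; positions \<open>0\<close> and \<open>card S + 1\<close> hold the
  conventional values \<open>-1\<close> and \<open>2\<close>.\<close>

definition knot :: "real set \<Rightarrow> nat \<Rightarrow> real" where
  "knot S j =
     (if j = 0 then -1
      else if j = card S + 1 then 2
      else sorted_list_of_set S ! (j - 1))"

definition hat :: "real \<Rightarrow> real \<Rightarrow> real \<Rightarrow> real \<Rightarrow> real" where
  "hat u v w t =
     (if u \<le> t \<and> t \<le> v then (t - u) / (v - u)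
      else if v \<le> t \<and> t \<le> w then (w - t) / (w - v)
      else 0)"

text \<open>Only the values on \<open>{0..1}\<close> matter.\<close>

definition hat_basis :: "real set \<Rightarrow> nat \<Rightarrow> real \<Rightarrow> real" where
  "hat_basis S j = hat (knot S (j - 1)) (knot S j) (knot S (j + 1))"

definition E1 :: "real set \<Rightarrow> nat \<Rightarrow> real" where
  "E1 S j = (LINT t:{0..1}|lborel. hat_basis S j t)"

definition E2 :: "real set \<Rightarrow> nat \<Rightarrow> nat \<Rightarrow> real" where
  "E2 S j j' = (LINT t:{0..1}|lborel. hat_basis S j t * hat_basis S j' t)"


section \<open>The mode of the additive constrained Gaussian process model\<close>

definition covariance_function :: "(real \<Rightarrow> real \<Rightarrow> real) \<Rightarrow> bool" where
  "covariance_function k \<longleftrightarrow>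
     (\<forall>s\<in>{0..1}. \<forall>t\<in>{0..1}. k s t = k t s) \<and>
     (\<forall>T c. finite T \<and> T \<subseteq> {0..1} \<longrightarrow> 0 \<le> (\<Sum>s\<in>T. \<Sum>t\<in>T. c s * c t * k s t))"

text \<open>Matrices and vectors are indexed from 0, while knots, observations and variables are numbered
  from 1; this accounts for the shifts below. The observations are \<open>x 1, \<dots>, x n\<close>, and
  \<open>x a i\<close> is the \<open>i\<close>-th coordinate of \<open>x a\<close>.\<close>

definition knot_cov :: "(real \<Rightarrow> real \<Rightarrow> real) \<Rightarrow> real set \<Rightarrow> real mat" where
  "knot_cov k S = mat (card S) (card S) (\<lambda>(a, b). k (knot S (a + 1)) (knot S (b + 1)))"

definition design :: "nat \<Rightarrow> (nat \<Rightarrow> nat \<Rightarrow> real) \<Rightarrow> nat \<Rightarrow> real set \<Rightarrow> real mat" where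
  "design n x i S = mat n (card S) (\<lambda>(a, b). hat_basis S (b + 1) (x (a + 1) i))"

definition obs_cov ::
  "nat \<Rightarrow> (nat \<Rightarrow> nat \<Rightarrow> real) \<Rightarrow> real \<Rightarrow> (nat \<Rightarrow> real \<Rightarrow> real \<Rightarrow> real) \<Rightarrow> nat set \<Rightarrow>
   (nat \<Rightarrow> real set) \<Rightarrow> real mat" where
  "obs_cov n x \<tau>2 k A S =
     mat n n (\<lambda>ab. \<Sum>p\<in>A.
       (design n x p (S p) * knot_cov (k p) (S p) * transpose_mat (design n x p (S p))) $$ ab)
     + \<tau>2 \<cdot>\<^sub>m 1\<^sub>m n"

text \<open>\<open>mat_inverse\<close> returns \<open>None\<close> exactly on non-invertible matrices.\<close>

definition inv_mat :: "real mat \<Rightarrow> real mat" where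
  "inv_mat M = the (mat_inverse M)"

definition mu_c ::
  "nat \<Rightarrow> (nat \<Rightarrow> nat \<Rightarrow> real) \<Rightarrow> real vec \<Rightarrow> real \<Rightarrow> (nat \<Rightarrow> real \<Rightarrow> real \<Rightarrow> real) \<Rightarrow>
   nat set \<Rightarrow> (nat \<Rightarrow> real set) \<Rightarrow> nat \<Rightarrow> real vec" where
  "mu_c n x y \<tau>2 k A S i =
     (knot_cov (k i) (S i) * transpose_mat (design n x i (S i)) * inv_mat (obs_cov n x \<tau>2 k A S))
       *\<^sub>v y"

definition Sigma_c_block ::
  "nat \<Rightarrow> (nat \<Rightarrow> nat \<Rightarrow> real) \<Rightarrow> real \<Rightarrow> (nat \<Rightarrow> real \<Rightarrow> real \<Rightarrow> real) \<Rightarrow> nat set \<Rightarrow>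
   (nat \<Rightarrow> real set) \<Rightarrow> nat \<Rightarrow> nat \<Rightarrow> real mat" where
  "Sigma_c_block n x \<tau>2 k A S i j =
     (if i = j then knot_cov (k i) (S i) else 0\<^sub>m (card (S i)) (card (S j)))
     - knot_cov (k i) (S i) * transpose_mat (design n x i (S i)) * inv_mat (obs_cov n x \<tau>2 k A S)
         * design n x j (S j) * knot_cov (k j) (S j)"

text \<open>Assembling blocks: the pairs (block, position inside the block), with the blocks in increasing
  order of their labels, number the rows and columns of a block matrix.\<close>

definition block_index :: "nat set \<Rightarrow> (nat \<Rightarrow> nat) \<Rightarrow> (nat \<times> nat) list" where
  "block_index A m = [(i, a). i \<leftarrow> sorted_list_of_set A, a \<leftarrow> [0..<m i]]"

definition block_vec :: "nat set \<Rightarrow> (nat \<Rightarrow> nat) \<Rightarrow> (nat \<Rightarrow> real vec) \<Rightarrow> real vec" where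
  "block_vec A m v =
     vec (length (block_index A m)) (\<lambda>p. case block_index A m ! p of (i, a) \<Rightarrow> v i $ a)"

definition block_mat :: "nat set \<Rightarrow> (nat \<Rightarrow> nat) \<Rightarrow> (nat \<Rightarrow> nat \<Rightarrow> real mat) \<Rightarrow> real mat" where
  "block_mat A m B =
     mat (length (block_index A m)) (length (block_index A m))
       (\<lambda>(p, q). case (block_index A m ! p, block_index A m ! q) of
          ((i, a), (j, b)) \<Rightarrow> B i j $$ (a, b))"

definition Sigma_c ::
  "nat \<Rightarrow> (nat \<Rightarrow> nat \<Rightarrow> real) \<Rightarrow> real \<Rightarrow> (nat \<Rightarrow> real \<Rightarrow> real \<Rightarrow> real) \<Rightarrow> nat set \<Rightarrow>
   (nat \<Rightarrow> real set) \<Rightarrow> real mat" where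
  "Sigma_c n x \<tau>2 k A S = block_mat A (\<lambda>i. card (S i)) (Sigma_c_block n x \<tau>2 k A S)"

text \<open>The constraint data of variable \<open>i\<close> is a function of its subdivision. The bounds are extended
  reals, since one-sided constraints such as monotonicity have infinite bounds.\<close>

definition feasible_coeffs ::
  "(nat \<Rightarrow> real set \<Rightarrow> real mat) \<Rightarrow> (nat \<Rightarrow> real set \<Rightarrow> ereal vec) \<Rightarrow>
   (nat \<Rightarrow> real set \<Rightarrow> ereal vec) \<Rightarrow> nat set \<Rightarrow> (nat \<Rightarrow> real set) \<Rightarrow> (nat \<Rightarrow> real vec) set" where
  "feasible_coeffs \<Lambda> l u A S =
     {c \<in> (\<Pi>\<^sub>E i\<in>A. carrier_vec (card (S i))).
        \<forall>i\<in>A. \<forall>r < dim_row (\<Lambda> i (S i)).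
          l i (S i) $ r \<le> ereal ((\<Lambda> i (S i) *\<^sub>v c i) $ r) \<and>
          ereal ((\<Lambda> i (S i) *\<^sub>v c i) $ r) \<le> u i (S i) $ r}"

definition mode_objective ::
  "nat \<Rightarrow> (nat \<Rightarrow> nat \<Rightarrow> real) \<Rightarrow> real vec \<Rightarrow> real \<Rightarrow> (nat \<Rightarrow> real \<Rightarrow> real \<Rightarrow> real) \<Rightarrow>
   nat set \<Rightarrow> (nat \<Rightarrow> real set) \<Rightarrow> (nat \<Rightarrow> real vec) \<Rightarrow> real" where
  "mode_objective n x y \<tau>2 k A S c =
     (let e = block_vec A (\<lambda>i. card (S i)) (\<lambda>i. c i - mu_c n x y \<tau>2 k A S i)
      in e \<bullet> (inv_mat (Sigma_c n x \<tau>2 k A S) *\<^sub>v e))"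

definition mode_coeff ::
  "nat \<Rightarrow> (nat \<Rightarrow> nat \<Rightarrow> real) \<Rightarrow> real vec \<Rightarrow> real \<Rightarrow> (nat \<Rightarrow> real \<Rightarrow> real \<Rightarrow> real) \<Rightarrow>
   (nat \<Rightarrow> real set \<Rightarrow> real mat) \<Rightarrow> (nat \<Rightarrow> real set \<Rightarrow> ereal vec) \<Rightarrow>
   (nat \<Rightarrow> real set \<Rightarrow> ereal vec) \<Rightarrow> nat set \<Rightarrow> (nat \<Rightarrow> real set) \<Rightarrow> nat \<Rightarrow> nat \<Rightarrow> real" where
  "mode_coeff n x y \<tau>2 k \<Lambda> l u A S i j =
     arg_min_on (mode_objective n x y \<tau>2 k A S) (feasible_coeffs \<Lambda> l u A S) i $ (j - 1)"

definition mode_function ::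
  "nat \<Rightarrow> (nat \<Rightarrow> nat \<Rightarrow> real) \<Rightarrow> real vec \<Rightarrow> real \<Rightarrow> (nat \<Rightarrow> real \<Rightarrow> real \<Rightarrow> real) \<Rightarrow>
   (nat \<Rightarrow> real set \<Rightarrow> real mat) \<Rightarrow> (nat \<Rightarrow> real set \<Rightarrow> ereal vec) \<Rightarrow>
   (nat \<Rightarrow> real set \<Rightarrow> ereal vec) \<Rightarrow> nat set \<Rightarrow> (nat \<Rightarrow> real set) \<Rightarrow> (nat \<Rightarrow> real) \<Rightarrow> real" where
  "mode_function n x y \<tau>2 k \<Lambda> l u A S z =
     (\<Sum>i\<in>A. \<Sum>j=1..card (S i). mode_coeff n x y \<tau>2 k \<Lambda> l u A S i j * hat_basis (S i) j (z i))"

text \<open>The constraint data needs the right shape only at the subdivisions in use.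
  Invertibility of \<open>obs_cov\<close> is not listed, since it follows from \<open>\<tau>2 > 0\<close>.\<close>

definition admissible_model ::
  "nat \<Rightarrow> (nat \<Rightarrow> nat \<Rightarrow> real) \<Rightarrow> real \<Rightarrow> (nat \<Rightarrow> real \<Rightarrow> real \<Rightarrow> real) \<Rightarrow>
   (nat \<Rightarrow> real set \<Rightarrow> real mat) \<Rightarrow> (nat \<Rightarrow> real set \<Rightarrow> ereal vec) \<Rightarrow>
   (nat \<Rightarrow> real set \<Rightarrow> ereal vec) \<Rightarrow> nat set \<Rightarrow> (nat \<Rightarrow> real set) \<Rightarrow> bool" where
  "admissible_model n x \<tau>2 k \<Lambda> l u A S \<longleftrightarrow>
     (\<forall>i\<in>A. subdivision (S i) \<and> covariance_function (k i) \<and>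
        dim_col (\<Lambda> i (S i)) = card (S i) \<and>
        dim_vec (l i (S i)) = dim_row (\<Lambda> i (S i)) \<and>
        dim_vec (u i (S i)) = dim_row (\<Lambda> i (S i))) \<and>
     invertible_mat (Sigma_c n x \<tau>2 k A S) \<and>
     feasible_coeffs \<Lambda> l u A S \<noteq> {}"


section \<open>The closed-form expression and its evaluation cost\<close>

text \<open>\<open>a\<close> and \<open>b\<close> are the coefficients of the smaller and of the larger model; \<open>F\<close> and \<open>G\<close> are the
  first and second moments of the basis functions. The cross moments occur only for neighbouring
  indices.\<close>

definition closed_form ::
  "nat set \<Rightarrow> nat \<Rightarrow> (nat \<Rightarrow> nat) \<Rightarrow> (nat \<Rightarrow> nat \<Rightarrow> real) \<Rightarrow> (nat \<Rightarrow> nat \<Rightarrow> nat \<Rightarrow> real) \<Rightarrow>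
   (nat \<Rightarrow> nat \<Rightarrow> real) \<Rightarrow> (nat \<Rightarrow> nat \<Rightarrow> real) \<Rightarrow> real" where
  "closed_form J istar m F G a b =
     (let \<eta> = (\<lambda>i j. a i j - b i j);
          \<eta>star = b istar 2 - b istar 1;
          \<zeta>star = b istar 1 + b istar 2
      in (\<Sum>i\<in>J. \<Sum>(j, j') | j \<in> {1..m i} \<and> j' \<in> {1..m i} \<and> \<bar>int j - int j'\<bar> \<le> 1.
            \<eta> i j * \<eta> i j' * G i j j')
         - (\<Sum>i\<in>J. (\<Sum>j=1..m i. \<eta> i j * F i j)\<^sup>2)
         + \<eta>star\<^sup>2 / 12
         + ((\<Sum>i\<in>J. \<Sum>j=1..m i. \<eta> i j * F i j) - \<zeta>star / 2)\<^sup>2)"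

text \<open>Cost model: arithmetic formulas over symbolic inputs, in which each arithmetic operation, each
  constant and each reading of an input costs one unit. Intermediate results cannot be shared, so an
  upper bound here is also one for straight-line programs.\<close>

datatype 'v arith =
    Const int
  | Input 'v
  | Plus "'v arith" "'v arith"
  | Minus "'v arith" "'v arith"
  | Times "'v arith" "'v arith"
  | Divide "'v arith" "'v arith"

primrec value_of :: "('v \<Rightarrow> real) \<Rightarrow> 'v arith \<Rightarrow> real" where
  "value_of \<rho> (Const z) = of_int z"
| "value_of \<rho> (Input v) = \<rho> v"
| "value_of \<rho> (Plus p q) = value_of \<rho> p + value_of \<rho> q"
| "value_of \<rho> (Minus p q) = value_of \<rho> p - value_of \<rho> q"
| "value_of \<rho> (Times p q) = value_of \<rho> p * value_of \<rho> q"
| "value_of \<rho> (Divide p q) = value_of \<rho> p / value_of \<rho> q"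

primrec cost :: "'v arith \<Rightarrow> nat" where
  "cost (Const z) = 1"
| "cost (Input v) = 1"
| "cost (Plus p q) = cost p + cost q + 1"
| "cost (Minus p q) = cost p + cost q + 1"
| "cost (Times p q) = cost p + cost q + 1"
| "cost (Divide p q) = cost p + cost q + 1"

datatype symbol = Knot nat nat | Small_Coeff nat nat | Large_Coeff nat nat

primrec assignment ::
  "(nat \<Rightarrow> real set) \<Rightarrow> (nat \<Rightarrow> nat \<Rightarrow> real) \<Rightarrow> (nat \<Rightarrow> nat \<Rightarrow> real) \<Rightarrow> symbol \<Rightarrow> real" where
  "assignment S a b (Knot i j) = knot (S i) j"
| "assignment S a b (Small_Coeff i j) = a i j"
| "assignment S a b (Large_Coeff i j) = b i j"

end

theory Submission
  imports Defs
begin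

text \<open>The difference of the two mode functions is additive, a sum of terms \<open>g i (z i)\<close>, so on
  the unit cube its terms behave like independent random variables: the integral of the square is
  the sum of the variances plus the square of the sum of the means. Each \<open>g i\<close> is a combination
  of hat functions, whose moments reduce to integrals of affine ramps; the new variable contributes
  the variance \<open>\<eta>\<^sup>2 / 12\<close> and the mean \<open>- \<zeta> / 2\<close>. Since the Gram matrix of the hat functions is
  tridiagonal, a formula with at most three terms per knot evaluates the result.\<close>

section \<open>Hat functions as clipped minima of ramps, and their continuity\<close>

text \<open>Left of \<open>v\<close> the rising ramp is at most 1 and the falling one at least 1,
  and right of \<open>v\<close> the roles swap, so the minimum always picks the active ramp;
  clipping at 0 handles points outside the support. Continuity is immediate in this form.\<close>

lemma hat_eq_max_min:
  assumes "u < v" "v < w"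
  shows "hat u v w t = max 0 (min ((t - u) / (v - u)) ((w - t) / (w - v)))"
proof (cases "t \<le> v")
  case True
  then have "(t - u) / (v - u) \<le> 1" "1 \<le> (w - t) / (w - v)"
    using assms by (simp_all add: field_simps)
  then have "min ((t - u) / (v - u)) ((w - t) / (w - v)) = (t - u) / (v - u)"
    by linarith
  then show ?thesis
    using True assms by (auto simp: hat_def max_def zero_le_divide_iff divide_le_0_iff)
next
  case False
  then have "1 \<le> (t - u) / (v - u)" "(w - t) / (w - v) \<le> 1"
    using assms by (simp_all add: field_simps)
  then have "min ((t - u) / (v - u)) ((w - t) / (w - v)) = (w - t) / (w - v)"
    by linarith
  then show ?thesis
    using False assms by (auto simp: hat_def max_def zero_le_divide_iff divide_le_0_iff)
qed

lemma continuous_on_hat: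
  assumes "u < v" "v < w"
  shows "continuous_on A (hat u v w)"
proof -
  have "continuous_on A (\<lambda>t. max 0 (min ((t - u) / (v - u)) ((w - t) / (w - v))))"
    using assms by (intro continuous_intros) auto
  then show ?thesis
    by (simp add: hat_eq_max_min[OF assms] fun_eq_iff)
qed

section \<open>Integrals of affine ramps\<close>

lemma has_integral_ramp_up:
  fixes u v :: real
  assumes "u < v"
  shows "((\<lambda>t. (t - u) / (v - u)) has_integral (v - u) / 2) {u..v}"
proof -
  \<comment> \<open>The slope is kept as a free constant \<open>c\<close>, so that the
    antiderivative is a polynomial; it is set to \<open>1 / (v - u)\<close> only afterwards.\<close>
  have "((\<lambda>t. c * (t - u)) has_integral c / 2 * (v - u)\<^sup>2 - c / 2 * (u - u)\<^sup>2) {u..v}" for c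
    using assms
    by (intro fundamental_theorem_of_calculus)
       (auto intro!: derivative_eq_intros simp flip: has_real_derivative_iff_has_vector_derivative)
  from this[of "1 / (v - u)"] show ?thesis
    using assms
    by (simp add: power2_eq_square del: right_diff_distrib_numeral left_diff_distrib_numeral)
qed

lemma has_integral_ramp_up_squared:
  fixes u v :: real
  assumes "u < v"
  shows "((\<lambda>t. ((t - u) / (v - u))\<^sup>2) has_integral (v - u) / 3) {u..v}"
proof -
  have "((\<lambda>t. (c * (t - u))\<^sup>2) has_integral
      c\<^sup>2 / 3 * (v - u) ^ 3 - c\<^sup>2 / 3 * (u - u) ^ 3) {u..v}" for c
    using assms
    by (intro fundamental_theorem_of_calculus)
       (auto intro!: derivative_eq_intros simp flip: has_real_derivative_iff_has_vector_derivative
             simp: power_mult_distrib)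
  from this[of "1 / (v - u)"] show ?thesis
    using assms by (simp add: power_divide power2_eq_square power3_eq_cube)
qed

text \<open>Since the two ramps on a segment add up to 1, integrals involving the falling ramp
  reduce to integrals of the rising one.\<close>

lemma ramp_down_eq:
  fixes v w t :: real
  assumes "v < w"
  shows "(w - t) / (w - v) = 1 - (t - v) / (w - v)"
  using assms by (simp add: field_simps)

lemma has_integral_ramp_down:
  fixes v w :: real
  assumes "v < w"
  shows "((\<lambda>t. (w - t) / (w - v)) has_integral (w - v) / 2) {v..w}"
proof -
  have "((\<lambda>t. 1 - (t - v) / (w - v)) has_integral (w - v) - (w - v) / 2) {v..w}"
    using assms has_integral_const_real[of "1::real" v w]
    by (intro has_integral_diff has_integral_ramp_up) auto
  then show ?thesis
    by (simp only: ramp_down_eq[OF assms]) (simp add: field_simps)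
qed

text \<open>With \<open>r\<close> the rising ramp the integrand is
  \<open>(1 - r) * r = r - r^2\<close>, which gives 1/2 - 1/3 = 1/6 of the length.\<close>

lemma has_integral_ramp_product:
  fixes v w :: real
  assumes "v < w"
  shows "((\<lambda>t. (w - t) / (w - v) * ((t - v) / (w - v))) has_integral (w - v) / 6) {v..w}"
proof -
  have "((\<lambda>t. (t - v) / (w - v) - ((t - v) / (w - v))\<^sup>2) has_integral (w - v) / 2 - (w - v) / 3) {v..w}"
    by (intro has_integral_diff has_integral_ramp_up has_integral_ramp_up_squared assms)
  moreover have "(t - v) / (w - v) - ((t - v) / (w - v))\<^sup>2
      = (w - t) / (w - v) * ((t - v) / (w - v))" for t
    by (simp only: ramp_down_eq[OF assms])
       (simp add: left_diff_distrib right_diff_distrib power2_eq_square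
             del: times_divide_eq_left times_divide_eq_right times_divide_times_eq)
  moreover have "(w - v) / 2 - (w - v) / 3 = (w - v) / 6"
    by simp
  ultimately show ?thesis
    by (simp only:)
qed

text \<open>With \<open>q\<close> the falling and \<open>r\<close> the rising ramp,
  \<open>q^2 = q - q * r\<close>, so no further antiderivative has to be found.\<close>

lemma has_integral_ramp_down_squared:
  fixes v w :: real
  assumes "v < w"
  shows "((\<lambda>t. ((w - t) / (w - v))\<^sup>2) has_integral (w - v) / 3) {v..w}"
proof -
  have "((\<lambda>t. (w - t) / (w - v) - (w - t) / (w - v) * ((t - v) / (w - v)))
      has_integral (w - v) / 2 - (w - v) / 6) {v..w}"
    by (intro has_integral_diff has_integral_ramp_down has_integral_ramp_product assms)
  moreover have "(w - t) / (w - v) - (w - t) / (w - v) * ((t - v) / (w - v))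
      = ((w - t) / (w - v))\<^sup>2" for t
    by (simp only: ramp_down_eq[OF assms])
       (simp add: left_diff_distrib right_diff_distrib power2_eq_square
             del: times_divide_eq_left times_divide_eq_right times_divide_times_eq)
  moreover have "(w - v) / 2 - (w - v) / 6 = (w - v) / 3"
    by simp
  ultimately show ?thesis
    by (simp only:)
qed

text \<open>Serves to pass from the support of a hat to the unit interval, by padding with a stretch
  where the integrand vanishes.\<close>

lemma has_integral_extend_left:
  fixes f :: "real \<Rightarrow> real"
  assumes "(f has_integral I) {u..v}" "a \<le> u" "u \<le> v" "\<And>t. t \<le> u \<Longrightarrow> f t = 0"
  shows "(f has_integral I) {a..v}"
  using has_integral_combine[OF assms(2,3) has_integral_is_0 assms(1)] assms(4) by auto

lemma has_integral_extend_right: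
  fixes f :: "real \<Rightarrow> real"
  assumes "(f has_integral I) {v..w}" "w \<le> b" "v \<le> w" "\<And>t. w \<le> t \<Longrightarrow> f t = 0"
  shows "(f has_integral I) {v..b}"
  using has_integral_combine[OF assms(3,2) assms(1) has_integral_is_0] assms(4) by auto

text \<open>Bridge between the Lebesgue integrals that define the moments and the gauge integrals in
  which they are computed; continuity supplies integrability.\<close>

lemma set_lebesgue_integral_eq_has_integral:
  fixes f :: "real \<Rightarrow> real"
  assumes "continuous_on {a..b} f" "(f has_integral I) {a..b}"
  shows "(LINT t:{a..b}|lborel. f t) = I"
  using set_borel_integral_eq_integral(2)[OF borel_integrable_atLeastAtMost'[OF assms(1)]] assms(2)
  by (simp add: integral_unique)

section \<open>Knots, hat basis functions and their moments for one subdivision\<close>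

context
  fixes S :: "real set"
  assumes S: "subdivision S"
begin

lemma card_subdivision_ge_2: "2 \<le> card S"
proof -
  have "card {0, 1 :: real} \<le> card S"
    using S by (intro card_mono) (auto simp: subdivision_def)
  then show ?thesis by simp
qed

lemma knot_in:
  assumes "j \<in> {1..card S}"
  shows "knot S j \<in> S"
proof -
  have "finite S" using S by (simp add: subdivision_def)
  then show ?thesis
    using assms nth_mem[of "j - 1" "sorted_list_of_set S"] by (auto simp: knot_def)
qed

lemma knot_bounds:
  assumes "j \<in> {1..card S}"
  shows "0 \<le> knot S j" "knot S j \<le> 1"
  using knot_in[OF assms] S by (auto simp: subdivision_def)

text \<open>The conventional outer knots -1 and 2 are included, so both ramps of every basis
  function have positive width, even at the two ends. Between genuine knots the reason is strict
  sortedness of the list.\<close>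

lemma knot_less:
  assumes "i < j" "j \<le> card S + 1"
  shows "knot S i < knot S j"
proof -
  consider "i = 0" "j = card S + 1" | "i = 0" "j \<in> {1..card S}"
    | "i \<in> {1..card S}" "j = card S + 1" | "i \<in> {1..card S}" "j \<in> {1..card S}"
    using assms by fastforce
  then show ?thesis
  proof cases
    case 4
    then show ?thesis
      using assms sorted_wrt_nth_less[OF strict_sorted_list_of_set[of S], of "i - 1" "j - 1"]
      by (auto simp: knot_def)
  next
    case 2
    then show ?thesis using knot_bounds[of j] by (simp add: knot_def[of S 0])
  next
    case 3
    then show ?thesis using knot_bounds[of i] by (simp add: knot_def[of S "Suc (card S)"])
  qed (simp add: knot_def)
qed

lemma knot_surj:
  assumes "s \<in> S"
  obtains j where "j \<in> {1..card S}" "knot S j = s"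
proof -
  have "finite S" using S by (simp add: subdivision_def)
  then have "s \<in> set (sorted_list_of_set S)"
    using assms by simp
  then obtain p where "p < card S" "sorted_list_of_set S ! p = s"
    unfolding in_set_conv_nth by auto
  then show ?thesis
    by (intro that[of "Suc p"]) (auto simp: knot_def)
qed

lemma knot_mono:
  assumes "i \<le> j" "j \<le> card S + 1"
  shows "knot S i \<le> knot S j"
  using knot_less[of i j] assms by (cases "i = j") auto

lemma knot_first: "knot S 1 = 0"
proof -
  obtain j where j: "j \<in> {1..card S}" "knot S j = 0"
    using knot_surj[of 0] S by (auto simp: subdivision_def)
  then show ?thesis
    using knot_mono[of 1 j] knot_bounds(1)[of 1] card_subdivision_ge_2 by auto
qed

lemma knot_last: "knot S (card S) = 1"
proof -
  obtain j where j: "j \<in> {1..card S}" "knot S j = 1"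
    using knot_surj[of 1] S by (auto simp: subdivision_def)
  then show ?thesis
    using knot_mono[of j "card S"] knot_bounds(2)[of "card S"] card_subdivision_ge_2 by auto
qed

lemma continuous_on_hat_basis:
  assumes "j \<in> {1..card S}"
  shows "continuous_on A (hat_basis S j)"
  unfolding hat_basis_def
  using assms by (intro continuous_on_hat knot_less) auto

text \<open>The outer knots of the support are included, so that padding an interval applies right
  at its boundary.\<close>

lemma hat_basis_eq_0:
  assumes "j \<in> {1..card S}" "t \<le> knot S (j - 1) \<or> knot S (j + 1) \<le> t"
  shows "hat_basis S j t = 0"
  using assms knot_less[of "j - 1" j] knot_less[of j "j + 1"]
  by (auto simp: hat_basis_def hat_def)

lemma hat_basis_up:
  assumes "j \<in> {1..card S}" "t \<in> {knot S (j - 1)..knot S j}"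
  shows "hat_basis S j t = (t - knot S (j - 1)) / (knot S j - knot S (j - 1))"
  using assms by (auto simp: hat_basis_def hat_def)

lemma hat_basis_down:
  assumes "j \<in> {1..card S}" "t \<in> {knot S j..knot S (j + 1)}"
  shows "hat_basis S j t = (knot S (j + 1) - t) / (knot S (j + 1) - knot S j)"
  \<comment> \<open>At \<open>t = knot S j\<close> the first branch of \<open>hat\<close> decides;
    both ramps equal 1 there because neither width is 0.\<close>
  using assms knot_less[of "j - 1" j] knot_less[of j "j + 1"]
  by (auto simp: hat_basis_def hat_def)

text \<open>The moments are split at the peak of the hat. For \<open>j = 1\<close> the left piece is
  the single point 0, so the ramp from the outer knot -1 contributes nothing.\<close>

lemma hat_basis_has_integral_left:
  assumes j: "j \<in> {1..card S}"
  defines "t \<equiv> knot S"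
  shows "(hat_basis S j has_integral (if j = 1 then 0 else (t j - t (j - 1)) / 2)) {0..t j}"
    and "((\<lambda>s. (hat_basis S j s)\<^sup>2) has_integral
      (if j = 1 then 0 else (t j - t (j - 1)) / 3)) {0..t j}"
proof -
  have *: "0 \<le> t (j - 1)" "t (j - 1) < t j" if "j \<noteq> 1"
  proof -
    have "j - 1 \<in> {1..card S}"
      using that j unfolding atLeastAtMost_iff by linarith
    then show "0 \<le> t (j - 1)" "t (j - 1) < t j"
      using j knot_bounds[of "j - 1"] knot_less[of "j - 1" j] by (simp_all add: t_def)
  qed
  have "(hat_basis S j has_integral (t j - t (j - 1)) / 2) {0..t j}" if "j \<noteq> 1"
  proof (rule has_integral_extend_left)
    show "(hat_basis S j has_integral (t j - t (j - 1)) / 2) {t (j - 1)..t j}"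
      using has_integral_ramp_up[OF *(2)[OF that]]
      by (rule has_integral_eq[rotated]) (use hat_basis_up[OF j] in \<open>simp add: t_def\<close>)
  qed (use * that hat_basis_eq_0[OF j] in \<open>auto simp: t_def\<close>)
  then show "(hat_basis S j has_integral (if j = 1 then 0 else (t j - t (j - 1)) / 2)) {0..t j}"
    using knot_first by (auto simp: t_def)
  have "((\<lambda>s. (hat_basis S j s)\<^sup>2) has_integral (t j - t (j - 1)) / 3) {0..t j}" if "j \<noteq> 1"
  proof (rule has_integral_extend_left)
    show "((\<lambda>s. (hat_basis S j s)\<^sup>2) has_integral (t j - t (j - 1)) / 3) {t (j - 1)..t j}"
      using has_integral_ramp_up_squared[OF *(2)[OF that]]
      by (rule has_integral_eq[rotated]) (use hat_basis_up[OF j] in \<open>simp add: t_def\<close>)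
  qed (use * that hat_basis_eq_0[OF j] in \<open>auto simp: t_def\<close>)
  then show "((\<lambda>s. (hat_basis S j s)\<^sup>2) has_integral
      (if j = 1 then 0 else (t j - t (j - 1)) / 3)) {0..t j}"
    using knot_first by (auto simp: t_def)
qed

lemma hat_basis_has_integral_right:
  assumes j: "j \<in> {1..card S}"
  defines "t \<equiv> knot S"
  shows "(hat_basis S j has_integral (if j = card S then 0 else (t (j + 1) - t j) / 2)) {t j..1}"
    and "((\<lambda>s. (hat_basis S j s)\<^sup>2) has_integral
      (if j = card S then 0 else (t (j + 1) - t j) / 3)) {t j..1}"
proof -
  have *: "t (j + 1) \<le> 1" "t j < t (j + 1)" if "j \<noteq> card S"
    using that j knot_bounds[of "j + 1"] knot_less[of j "j + 1"] by (auto simp: t_def)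
  have "(hat_basis S j has_integral (t (j + 1) - t j) / 2) {t j..1}" if "j \<noteq> card S"
  proof (rule has_integral_extend_right)
    show "(hat_basis S j has_integral (t (j + 1) - t j) / 2) {t j..t (j + 1)}"
      using has_integral_ramp_down[OF *(2)[OF that]]
      by (rule has_integral_eq[rotated]) (use hat_basis_down[OF j] in \<open>simp add: t_def\<close>)
  qed (use * that hat_basis_eq_0[OF j] in \<open>auto simp: t_def\<close>)
  then show "(hat_basis S j has_integral (if j = card S then 0 else (t (j + 1) - t j) / 2)) {t j..1}"
    using knot_last by (auto simp: t_def)
  have "((\<lambda>s. (hat_basis S j s)\<^sup>2) has_integral (t (j + 1) - t j) / 3) {t j..1}" if "j \<noteq> card S"
  proof (rule has_integral_extend_right)
    show "((\<lambda>s. (hat_basis S j s)\<^sup>2) has_integral (t (j + 1) - t j) / 3) {t j..t (j + 1)}"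
      using has_integral_ramp_down_squared[OF *(2)[OF that]]
      by (rule has_integral_eq[rotated]) (use hat_basis_down[OF j] in \<open>simp add: t_def\<close>)
  qed (use * that hat_basis_eq_0[OF j] in \<open>auto simp: t_def\<close>)
  then show "((\<lambda>s. (hat_basis S j s)\<^sup>2) has_integral
      (if j = card S then 0 else (t (j + 1) - t j) / 3)) {t j..1}"
    using knot_last by (auto simp: t_def)
qed

text \<open>The pieces on the two sides of the peak are added; in the interior the position of the
  peak cancels. Having at least two knots keeps the two end cases apart.\<close>

lemma E1_eq:
  assumes j: "j \<in> {1..card S}"
  defines "t \<equiv> knot S"
  shows "E1 S j = (if j = 1 then t 2 / 2
                   else if j = card S then (1 - t (card S - 1)) / 2
                   else (t (j + 1) - t (j - 1)) / 2)"
proof -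
  have "E1 S j = (if j = 1 then 0 else (t j - t (j - 1)) / 2)
      + (if j = card S then 0 else (t (j + 1) - t j) / 2)"
    unfolding E1_def t_def
    by (intro set_lebesgue_integral_eq_has_integral continuous_on_hat_basis
          has_integral_combine[of 0 "knot S j" 1] knot_bounds
          hat_basis_has_integral_left hat_basis_has_integral_right j)
  then show ?thesis
    using card_subdivision_ge_2 knot_first knot_last
    by (auto simp: t_def numeral_2_eq_2 field_simps split: if_splits)
qed

lemma E2_diag:
  assumes j: "j \<in> {1..card S}"
  defines "t \<equiv> knot S"
  shows "E2 S j j = (if j = 1 then (t 2 - t 1) / 3
                     else if j = card S then (t (card S) - t (card S - 1)) / 3
                     else (t (j + 1) - t (j - 1)) / 3)"
proof -
  have "E2 S j j = (if j = 1 then 0 else (t j - t (j - 1)) / 3)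
      + (if j = card S then 0 else (t (j + 1) - t j) / 3)"
    unfolding E2_def t_def power2_eq_square[symmetric]
    by (intro set_lebesgue_integral_eq_has_integral continuous_on_power continuous_on_hat_basis
          has_integral_combine[of 0 "knot S j" 1] knot_bounds
          hat_basis_has_integral_left hat_basis_has_integral_right j)
  then show ?thesis
    using card_subdivision_ge_2
    by (auto simp: t_def numeral_2_eq_2 field_simps split: if_splits)
qed

lemma E2_commute: "E2 S i j = E2 S j i"
  by (simp add: E2_def mult.commute)

text \<open>The supports of neighbouring hats overlap exactly in the segment between their peaks,
  where one falls while the other rises.\<close>

lemma E2_Suc:
  assumes j: "j \<in> {1..card S}" "Suc j \<in> {1..card S}"
  shows "E2 S j (Suc j) = (knot S (Suc j) - knot S j) / 6"
  unfolding E2_def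
proof (intro set_lebesgue_integral_eq_has_integral continuous_on_mult continuous_on_hat_basis j)
  let ?f = "\<lambda>s. hat_basis S j s * hat_basis S (Suc j) s"
  have less: "knot S j < knot S (Suc j)"
    using j by (intro knot_less) auto
  have "(?f has_integral (knot S (Suc j) - knot S j) / 6) {knot S j..knot S (Suc j)}"
    using has_integral_ramp_product[OF less]
    by (rule has_integral_eq[rotated]) (use hat_basis_down[OF j(1)] hat_basis_up[OF j(2)] in simp)
  then have "(?f has_integral (knot S (Suc j) - knot S j) / 6) {0..knot S (Suc j)}"
    by (rule has_integral_extend_left)
       (use less knot_bounds[OF j(1)] hat_basis_eq_0[OF j(2)] in auto)
  then show "(?f has_integral (knot S (Suc j) - knot S j) / 6) {0..1}"
    by (rule has_integral_extend_right)
       (use knot_bounds[OF j(2)] hat_basis_eq_0[OF j(1)] in auto)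
qed

text \<open>The hat \<open>i\<close> is 0 from \<open>knot S (i + 1)\<close> on and the hat
  \<open>j\<close> is 0 up to \<open>knot S (j - 1)\<close>; these two ranges cover the
  line.\<close>

lemma E2_far:
  assumes j: "i \<in> {1..card S}" "j \<in> {1..card S}" "i + 2 \<le> j"
  shows "E2 S i j = 0"
proof -
  have "knot S (i + 1) \<le> knot S (j - 1)"
    using j by (intro knot_mono) auto
  then have "hat_basis S i t * hat_basis S j t = 0" for t
    using hat_basis_eq_0[OF j(1), of t] hat_basis_eq_0[OF j(2), of t] by fastforce
  then show ?thesis
    unfolding E2_def set_lebesgue_integral_def by (simp only:) simp
qed

lemma E2_eq:
  assumes j: "j \<in> {1..card S}" "j' \<in> {1..card S}"
  defines "t \<equiv> knot S"
  shows "E2 S j j' =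
    (if j = j' \<and> j = 1 then (t 2 - t 1) / 3
     else if j = j' \<and> j = card S then (t (card S) - t (card S - 1)) / 3
     else if j = j' then (t (j + 1) - t (j - 1)) / 3
     else if j' = j + 1 then (t (j + 1) - t j) / 6
     else if j = j' + 1 then (t j - t (j - 1)) / 6
     else 0)"
proof -
  consider "j' = j" | "j' = Suc j" | "j = Suc j'" | "j + 2 \<le> j'" | "j' + 2 \<le> j"
    by linarith
  then show ?thesis
  proof cases
    case 1 then show ?thesis using E2_diag[OF j(1)] by (simp add: t_def)
  next
    case 2 then show ?thesis using E2_Suc[of j] j by (simp add: t_def)
  next
    case 3 then show ?thesis using E2_Suc[of j'] j E2_commute[of j j'] by (simp add: t_def)
  next
    case 4 then show ?thesis using E2_far[OF j] by simp
  next
    case 5 then show ?thesis using E2_far[OF j(2,1)] E2_commute[of j j'] by simp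
  qed
qed

end

section \<open>Moments of linear combinations of hat functions\<close>

lemma set_integral_sum:
  fixes f :: "'i \<Rightarrow> 'a \<Rightarrow> real"
  assumes "\<And>i. i \<in> I \<Longrightarrow> set_integrable M A (f i)"
  shows "(LINT t:A|M. \<Sum>i\<in>I. f i t) = (\<Sum>i\<in>I. LINT t:A|M. f i t)"
  using assms
  by (simp add: set_lebesgue_integral_def set_integrable_def sum_distrib_left)

lemma set_integrable_sum_real:
  fixes f :: "'i \<Rightarrow> 'a \<Rightarrow> real"
  assumes "\<And>i. i \<in> I \<Longrightarrow> set_integrable M A (f i)"
  shows "set_integrable M A (\<lambda>t. \<Sum>i\<in>I. f i t)"
  using assms by (simp add: set_integrable_def sum_distrib_left)

context
  fixes S :: "real set" and c :: "nat \<Rightarrow> real"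
  assumes S: "subdivision S"
begin

lemma continuous_on_hat_sum: "continuous_on A (\<lambda>t. \<Sum>j=1..card S. c j * hat_basis S j t)"
  by (intro continuous_intros continuous_on_hat_basis[OF S])

lemma integral_hat_sum:
  "(LINT t:{0..1}|lborel. \<Sum>j=1..card S. c j * hat_basis S j t) = (\<Sum>j=1..card S. c j * E1 S j)"
proof -
  have "set_integrable lborel {0..1} (hat_basis S j)" if "j \<in> {1..card S}" for j
    by (intro borel_integrable_atLeastAtMost' continuous_on_hat_basis[OF S] that)
  then show ?thesis
    unfolding E1_def
    by (subst set_integral_sum) (auto intro!: sum.cong)
qed

lemma integral_hat_sum_squared:
  "(LINT t:{0..1}|lborel. (\<Sum>j=1..card S. c j * hat_basis S j t)\<^sup>2)
   = (\<Sum>j=1..card S. \<Sum>j'=1..card S. c j * c j' * E2 S j j')"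
proof -
  have int: "set_integrable lborel {0..1} (\<lambda>t. hat_basis S j t * hat_basis S j' t)"
    if "j \<in> {1..card S}" "j' \<in> {1..card S}" for j j'
    by (intro borel_integrable_atLeastAtMost' continuous_on_mult continuous_on_hat_basis[OF S] that)
  have "(LINT t:{0..1}|lborel. (\<Sum>j=1..card S. c j * hat_basis S j t)\<^sup>2)
      = (LINT t:{0..1}|lborel. \<Sum>j=1..card S. \<Sum>j'=1..card S.
           c j * c j' * (hat_basis S j t * hat_basis S j' t))"
    by (simp add: power2_eq_square sum_product mult_ac)
  also have "\<dots> = (\<Sum>j=1..card S. LINT t:{0..1}|lborel. \<Sum>j'=1..card S.
      c j * c j' * (hat_basis S j t * hat_basis S j' t))"
    by (rule set_integral_sum)
       (auto intro!: set_integrable_sum_real set_integrable_mult_right int simp del: mult.assoc)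
  also have "\<dots> = (\<Sum>j=1..card S. \<Sum>j'=1..card S. LINT t:{0..1}|lborel.
      c j * c j' * (hat_basis S j t * hat_basis S j' t))"
    by (intro sum.cong refl set_integral_sum set_integrable_mult_right int) auto
  finally show ?thesis
    by (simp only: E2_def set_integral_mult_right)
qed

text \<open>Cross moments beyond neighbouring indices vanish; dropping them cuts a quadratic number
  of terms down to a linear one.\<close>

lemma E2_band_sum:
  "(\<Sum>j=1..card S. \<Sum>j'=1..card S. c j * c j' * E2 S j j')
   = (\<Sum>(j, j') | j \<in> {1..card S} \<and> j' \<in> {1..card S} \<and> \<bar>int j - int j'\<bar> \<le> 1. c j * c j' * E2 S j j')"
proof -
  have "(\<Sum>j=1..card S. \<Sum>j'=1..card S. c j * c j' * E2 S j j')
      = (\<Sum>(j, j')\<in>{1..card S} \<times> {1..card S}. c j * c j' * E2 S j j')"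
    by (simp add: sum.cartesian_product)
  also have "\<dots> = (\<Sum>(j, j') | j \<in> {1..card S} \<and> j' \<in> {1..card S} \<and> \<bar>int j - int j'\<bar> \<le> 1.
      c j * c j' * E2 S j j')"
    using E2_eq[OF S] by (intro sum.mono_neutral_right) (auto split: if_splits)
  finally show ?thesis .
qed

end

section \<open>Squares of additive functions on the unit box\<close>

text \<open>Here \<open>v\<close> and \<open>\<mu>\<close> stand for second moments and means.
  Splitting \<open>v p - (\<mu> p)^2\<close> off the diagonal leaves
  \<open>\<mu> p * \<mu> q\<close> for all pairs, whose double sum is the square of the sum.\<close>

lemma sum_diagonal_split:
  fixes v \<mu> :: "'i \<Rightarrow> real"
  assumes "finite I"
  shows "(\<Sum>p\<in>I. \<Sum>q\<in>I. if p = q then v p else \<mu> p * \<mu> q)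
    = (\<Sum>i\<in>I. v i) - (\<Sum>i\<in>I. (\<mu> i)\<^sup>2) + (\<Sum>i\<in>I. \<mu> i)\<^sup>2"
proof -
  have "(\<Sum>p\<in>I. \<Sum>q\<in>I. if p = q then v p else \<mu> p * \<mu> q)
      = (\<Sum>p\<in>I. \<Sum>q\<in>I. (if p = q then v p - (\<mu> p)\<^sup>2 else 0) + \<mu> p * \<mu> q)"
    by (intro sum.cong) (auto simp: power2_eq_square)
  also have "\<dots> = (\<Sum>i\<in>I. v i) - (\<Sum>i\<in>I. (\<mu> i)\<^sup>2) + (\<Sum>i\<in>I. \<mu> i)\<^sup>2"
    using assms by (simp add: sum.distrib sum_subtractf power2_eq_square sum_product)
  finally show ?thesis .
qed

text \<open>Expanding the square gives one term per pair \<open>(p, q)\<close>, each a product of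
  one-variable factors, so its integral factorises. A diagonal pair yields a second moment and any
  other pair a product of two means, since every remaining coordinate integrates to the length
  1.\<close>

lemma integral_unit_box_additive_squared:
  fixes g :: "'i \<Rightarrow> real \<Rightarrow> real"
  assumes I: "finite I" and g: "\<And>i. i \<in> I \<Longrightarrow> continuous_on {0..1} (g i)"
  defines "\<mu> \<equiv> \<lambda>i. LINT t:{0..1}|lborel. g i t"
  shows "(LINT z:(\<Pi>\<^sub>E i\<in>I. {0..1})|(\<Pi>\<^sub>M i\<in>I. lborel). (\<Sum>i\<in>I. g i (z i))\<^sup>2)
    = (\<Sum>i\<in>I. LINT t:{0..1}|lborel. (g i t)\<^sup>2) - (\<Sum>i\<in>I. (\<mu> i)\<^sup>2) + (\<Sum>i\<in>I. \<mu> i)\<^sup>2"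
proof -
  interpret product_sigma_finite "\<lambda>_ :: 'i. lborel :: real measure" ..
  \<comment> \<open>\<open>h p q i\<close> is the factor in coordinate \<open>i\<close> of the term
    for \<open>(p, q)\<close>. Two separate conditionals let \<open>p = q\<close> produce a square;
    the indicator of the box is distributed over the coordinates.\<close>
  define h where "h p q i t =
    indicator {0..1} t * ((if i = p then g i t else 1) * (if i = q then g i t else 1))" for p q i t
  have int_h: "integrable lborel (h p q i)" if "i \<in> I" for p q i
  proof -
    have "set_integrable lborel {0..1}
        (\<lambda>t. (if i = p then g i t else 1) * (if i = q then g i t else 1))"
      using g[OF that]
      by (intro borel_integrable_atLeastAtMost' continuous_on_mult;
          cases "i = p"; cases "i = q"; simp)
    then show ?thesis
      by (simp add: set_integrable_def h_def[abs_def])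
  qed
  have prod_h: "(\<Prod>i\<in>I. integral\<^sup>L lborel (h p q i))
      = (if p = q then LINT t:{0..1}|lborel. (g p t)\<^sup>2 else \<mu> p * \<mu> q)"
    if "p \<in> I" "q \<in> I" for p q
  proof (cases "p = q")
    case True
    have "integral\<^sup>L lborel (h p p i) = (if i = p then LINT t:{0..1}|lborel. (g p t)\<^sup>2 else 1)" for i
      by (auto simp: h_def[abs_def] set_lebesgue_integral_def power2_eq_square)
    then show ?thesis
      using I that True by simp
  next
    case False
    then have "integral\<^sup>L lborel (h p q i) = (if i = p then \<mu> i else 1) * (if i = q then \<mu> i else 1)" for i
      by (auto simp: h_def[abs_def] \<mu>_def set_lebesgue_integral_def)
    then show ?thesis
      using I that False by (simp add: prod.distrib)
  qed
  have "indicator (\<Pi>\<^sub>E i\<in>I. {0..1}) z *\<^sub>R (\<Sum>i\<in>I. g i (z i))\<^sup>2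
      = (\<Sum>p\<in>I. \<Sum>q\<in>I. \<Prod>i\<in>I. h p q i (z i))" if "z \<in> space (\<Pi>\<^sub>M i\<in>I. lborel)" for z
  proof -
    \<comment> \<open>Points of the product space are extensional, so lying in the box is a
      condition on the coordinates in \<open>I\<close> alone.\<close>
    have "indicator (\<Pi>\<^sub>E i\<in>I. {0..1}) z = (\<Prod>i\<in>I. indicator {0..1} (z i) :: real)"
      using that I by (auto simp: indicator_def space_PiM PiE_iff)
    moreover have "(\<Prod>i\<in>I. h p q i (z i))
        = (\<Prod>i\<in>I. indicator {0..1} (z i)) * (g p (z p) * g q (z q))" if "p \<in> I" "q \<in> I" for p q
      using I that by (simp add: h_def prod.distrib)
    ultimately show ?thesis
      unfolding power2_eq_square sum_product by (simp add: sum_distrib_left)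
  qed
  then have "(LINT z:(\<Pi>\<^sub>E i\<in>I. {0..1})|(\<Pi>\<^sub>M i\<in>I. lborel). (\<Sum>i\<in>I. g i (z i))\<^sup>2)
      = (LINT z|(\<Pi>\<^sub>M i\<in>I. lborel). (\<Sum>p\<in>I. \<Sum>q\<in>I. \<Prod>i\<in>I. h p q i (z i)))"
    unfolding set_lebesgue_integral_def by (intro Bochner_Integration.integral_cong) auto
  \<comment> \<open>Exchanging sums and integral needs every product to be integrable, which is
    inherited from its one-variable factors.\<close>
  also have "\<dots> = (\<Sum>p\<in>I. \<Sum>q\<in>I. (LINT z|(\<Pi>\<^sub>M i\<in>I. lborel). (\<Prod>i\<in>I. h p q i (z i))))"
    using product_integrable_prod[OF I int_h]
    by (subst Bochner_Integration.integral_sum | simp)+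
  also have "\<dots> = (\<Sum>p\<in>I. \<Sum>q\<in>I. if p = q then LINT t:{0..1}|lborel. (g p t)\<^sup>2 else \<mu> p * \<mu> q)"
    by (intro sum.cong refl) (simp only: product_integral_prod[OF I int_h] prod_h)
  finally show ?thesis
    by (simp add: sum_diagonal_split[OF I])
qed

section \<open>Arithmetic formulas for the closed form and their cost\<close>

text \<open>The closing \<open>Const 0\<close> gives the empty list a formula too; it is the extra
  unit in the cost bounds.\<close>

definition sum_arith :: "'v arith list \<Rightarrow> 'v arith" where
  "sum_arith es = foldr Plus es (Const 0)"

lemma value_of_sum_arith: "value_of \<rho> (sum_arith es) = (\<Sum>e\<leftarrow>es. value_of \<rho> e)"
  by (induction es) (simp_all add: sum_arith_def)

lemma cost_sum_arith: "cost (sum_arith es) = (\<Sum>e\<leftarrow>es. cost e + 1) + 1"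
  by (induction es) (simp_all add: sum_arith_def)

lemma cost_sum_arith_le:
  assumes "\<And>e. e \<in> set es \<Longrightarrow> cost e \<le> c"
  shows "cost (sum_arith es) \<le> (c + 1) * length es + 1"
  using assms by (induction es) (fastforce simp: cost_sum_arith)+

text \<open>The case distinction is resolved while the formula is built, from the indices alone, so
  only the chosen branch is paid for.\<close>

definition E1_arith :: "nat \<Rightarrow> nat \<Rightarrow> nat \<Rightarrow> symbol arith" where
  "E1_arith m i j =
     (if j = 1 then Divide (Input (Knot i 2)) (Const 2)
      else if j = m then Divide (Minus (Const 1) (Input (Knot i (m - 1)))) (Const 2)
      else Divide (Minus (Input (Knot i (j + 1))) (Input (Knot i (j - 1)))) (Const 2))"

definition E2_arith :: "nat \<Rightarrow> nat \<Rightarrow> nat \<Rightarrow> nat \<Rightarrow> symbol arith" where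
  "E2_arith m i j j' =
     (let diff = (\<lambda>a b. Minus (Input (Knot i a)) (Input (Knot i b))) in
      if j = j' \<and> j = 1 then Divide (diff 2 1) (Const 3)
      else if j = j' \<and> j = m then Divide (diff m (m - 1)) (Const 3)
      else if j = j' then Divide (diff (j + 1) (j - 1)) (Const 3)
      else if j' = j + 1 then Divide (diff (j + 1) j) (Const 6)
      else if j = j' + 1 then Divide (diff j (j - 1)) (Const 6)
      else Const 0)"

definition eta_arith :: "nat \<Rightarrow> nat \<Rightarrow> symbol arith" where
  "eta_arith i j = Minus (Input (Small_Coeff i j)) (Input (Large_Coeff i j))"

definition mean_arith :: "nat \<Rightarrow> nat \<Rightarrow> symbol arith" where
  "mean_arith m i = sum_arith (map (\<lambda>j. Times (eta_arith i j) (E1_arith m i j)) [1..<m + 1])"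

text \<open>Each row runs over \<open>j - 1\<close>, \<open>j\<close> and \<open>j + 1\<close> only,
  and the filter removes indices outside \<open>{1..m}\<close>; at most three terms per row keep the
  size linear in \<open>m\<close>.\<close>

definition band_arith :: "nat \<Rightarrow> nat \<Rightarrow> symbol arith" where
  "band_arith m i = sum_arith (map (\<lambda>j.
     sum_arith (map (\<lambda>j'. Times (Times (eta_arith i j) (eta_arith i j')) (E2_arith m i j j'))
       (filter (\<lambda>j'. j' \<in> {1..m}) [j - 1..<j + 2]))) [1..<m + 1])"

text \<open>Without sharing, a square is a product of two copies of a formula, so each mean and
  \<open>gap\<close> are paid for twice.\<close>

definition closed_form_arith :: "nat set \<Rightarrow> nat \<Rightarrow> (nat \<Rightarrow> nat) \<Rightarrow> symbol arith" where
  "closed_form_arith J istar m =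
     (let is = sorted_list_of_set J;
          star = (\<lambda>j. Input (Large_Coeff istar j));
          \<eta>star = Minus (star 2) (star 1);
          \<zeta>star = Plus (star 1) (star 2);
          gap = Minus (sum_arith (map (\<lambda>i. mean_arith (m i) i) is)) (Divide \<zeta>star (Const 2))
      in Plus
           (Plus
             (Minus
               (sum_arith (map (\<lambda>i. band_arith (m i) i) is))
               (sum_arith (map (\<lambda>i. Times (mean_arith (m i) i) (mean_arith (m i) i)) is)))
             (Divide (Times \<eta>star \<eta>star) (Const 12)))
           (Times gap gap))"

lemma cost_mean_arith: "cost (mean_arith m i) \<le> 10 * m + 1"
proof -
  \<comment> \<open>A term costs at most 9: 3 for the coefficient difference, at most 5 for the
    moment and 1 for the product.\<close>
  have "cost (mean_arith m i)
      \<le> (9 + 1) * length (map (\<lambda>j. Times (eta_arith i j) (E1_arith m i j)) [1..<m + 1]) + 1"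
    unfolding mean_arith_def
    by (rule cost_sum_arith_le) (auto simp: eta_arith_def E1_arith_def)
  then show ?thesis by (simp del: upt_Suc)
qed

lemma cost_band_arith: "cost (band_arith m i) \<le> 44 * m + 1"
proof -
  let ?term = "\<lambda>j j'. Times (Times (eta_arith i j) (eta_arith i j')) (E2_arith m i j j')"
  let ?js' = "\<lambda>j. filter (\<lambda>j'. j' \<in> {1..m}) [j - 1..<j + 2]"
  let ?row = "\<lambda>j. sum_arith (map (?term j) (?js' j))"
  \<comment> \<open>A term costs at most 13: two coefficient differences of 3, at most 5 for the
    cross moment, and two products. Three terms with their additions and the closing constant give
    \<open>3 * 14 + 1 = 43\<close>.\<close>
  have "cost (?row j) \<le> 43" if "1 \<le> j" for j
  proof -
    have "cost (?row j) \<le> (13 + 1) * length (map (?term j) (?js' j)) + 1"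
      by (rule cost_sum_arith_le) (auto simp: eta_arith_def E2_arith_def Let_def)
    moreover have "length (?js' j) \<le> 3"
      using that by (intro order_trans[OF length_filter_le]) (simp del: upt_Suc)
    ultimately show ?thesis by simp
  qed
  then have "cost (band_arith m i) \<le> (43 + 1) * length (map ?row [1..<m + 1]) + 1"
    unfolding band_arith_def by (intro cost_sum_arith_le) auto
  then show ?thesis by (simp del: upt_Suc)
qed

text \<open>The \<open>+ 1\<close> in the hypothesis pays for the addition that attaches a summand
  to the rest.\<close>

lemma cost_sum_over_set_le:
  fixes f :: "nat \<Rightarrow> 'v arith"
  assumes "finite J" "\<And>i. i \<in> J \<Longrightarrow> cost (f i) + 1 \<le> c * m i"
  shows "cost (sum_arith (map f (sorted_list_of_set J))) \<le> c * (\<Sum>i\<in>J. m i) + 1"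
proof -
  have "cost (sum_arith (map f (sorted_list_of_set J))) = (\<Sum>i\<in>J. cost (f i) + 1) + 1"
    using assms(1) by (simp add: cost_sum_arith comp_def sum.distinct_set_conv_list[symmetric] del: sum_list_Suc)
  also have "\<dots> \<le> (\<Sum>i\<in>J. c * m i) + 1"
    using assms(2) by (intro add_right_mono sum_mono) auto
  finally show ?thesis
    by (simp add: sum_distrib_left)
qed

text \<open>Two knots per variable absorb the constant overheads, for instance
  \<open>10 * m i + 2\<close> into \<open>11 * m i\<close>. The factors 45 and 22, together with 11
  for each copy of \<open>gap\<close>, add up to 89, so 94 leaves room; it also bounds the additive
  constant.\<close>

lemma cost_closed_form_arith:
  assumes "finite J" "\<And>i. i \<in> J \<Longrightarrow> 2 \<le> m i"
  shows "cost (closed_form_arith J istar m) \<le> 94 * (\<Sum>i\<in>J. m i) + 94"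
proof -
  let ?is = "sorted_list_of_set J"
  have "cost (sum_arith (map (\<lambda>i. mean_arith (m i) i) ?is)) \<le> 11 * (\<Sum>i\<in>J. m i) + 1"
  proof (rule cost_sum_over_set_le[OF assms(1)])
    fix i assume "i \<in> J"
    then show "cost (mean_arith (m i) i) + 1 \<le> 11 * m i"
      using cost_mean_arith[of "m i" i] assms(2)[of i] by linarith
  qed
  moreover have "cost (sum_arith (map (\<lambda>i. band_arith (m i) i) ?is)) \<le> 45 * (\<Sum>i\<in>J. m i) + 1"
  proof (rule cost_sum_over_set_le[OF assms(1)])
    fix i assume "i \<in> J"
    then show "cost (band_arith (m i) i) + 1 \<le> 45 * m i"
      using cost_band_arith[of "m i" i] assms(2)[of i] by linarith
  qed
  moreover have "cost (sum_arith (map (\<lambda>i. Times (mean_arith (m i) i) (mean_arith (m i) i)) ?is))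
      \<le> 22 * (\<Sum>i\<in>J. m i) + 1"
  proof (rule cost_sum_over_set_le[OF assms(1)])
    fix i assume "i \<in> J"
    then show "cost (Times (mean_arith (m i) i) (mean_arith (m i) i)) + 1 \<le> 22 * m i"
      using cost_mean_arith[of "m i" i] assms(2)[of i] by simp
  qed
  ultimately show ?thesis
    by (simp add: closed_form_arith_def Let_def)
qed

section \<open>Correctness of the formulas\<close>

context
  fixes S :: "nat \<Rightarrow> real set" and a b :: "nat \<Rightarrow> nat \<Rightarrow> real"
begin

lemma value_of_eta_arith: "value_of (assignment S a b) (eta_arith i j) = a i j - b i j"
  by (simp add: eta_arith_def)

lemma value_of_mean_arith:
  assumes "subdivision (S i)"
  shows "value_of (assignment S a b) (mean_arith (card (S i)) i)
    = (\<Sum>j=1..card (S i). (a i j - b i j) * E1 (S i) j)"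
proof -
  have "value_of (assignment S a b) (E1_arith (card (S i)) i j) = E1 (S i) j"
    if "j \<in> {1..card (S i)}" for j
    unfolding E1_eq[OF assms that] by (simp add: E1_arith_def)
  then have "value_of (assignment S a b) (mean_arith (card (S i)) i)
      = (\<Sum>j\<leftarrow>[1..<card (S i) + 1]. (a i j - b i j) * E1 (S i) j)"
    unfolding mean_arith_def value_of_sum_arith map_map
    by (intro arg_cong[of _ _ sum_list] map_cong) (auto simp: value_of_eta_arith)
  also have "\<dots> = (\<Sum>j=1..card (S i). (a i j - b i j) * E1 (S i) j)"
    by (simp only: sum.distinct_set_conv_list[symmetric] distinct_upt set_upt)
       (simp add: atLeastLessThanSuc_atLeastAtMost)
  finally show ?thesis .
qed

lemma value_of_band_arith:
  assumes "subdivision (S i)"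
  defines "m \<equiv> card (S i)"
  shows "value_of (assignment S a b) (band_arith m i)
    = (\<Sum>(j, j') | j \<in> {1..m} \<and> j' \<in> {1..m} \<and> \<bar>int j - int j'\<bar> \<le> 1.
         (a i j - b i j) * (a i j' - b i j') * E2 (S i) j j')"
proof -
  let ?term = "\<lambda>j j'. (a i j - b i j) * (a i j' - b i j') * E2 (S i) j j'"
  let ?js' = "\<lambda>j. filter (\<lambda>j'. j' \<in> {1..m}) [j - 1..<j + 2]"
  have "value_of (assignment S a b) (E2_arith m i j j') = E2 (S i) j j'"
    if "j \<in> {1..m}" "j' \<in> {1..m}" for j j'
    unfolding E2_eq[OF assms(1) that[unfolded m_def]] by (simp add: E2_arith_def Let_def m_def)
  then have "value_of (assignment S a b) (band_arith m i)
      = (\<Sum>j\<leftarrow>[1..<m + 1]. \<Sum>j'\<leftarrow>?js' j. ?term j j')"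
    unfolding band_arith_def value_of_sum_arith map_map
    by (intro arg_cong[of _ _ sum_list] map_cong refl)
       (auto simp: value_of_sum_arith value_of_eta_arith
             intro!: arg_cong[of _ _ sum_list] map_cong)
  \<comment> \<open>The lists have no repetitions, so sums over lists are sums over sets.\<close>
  also have "\<dots> = (\<Sum>j\<in>{1..m}. \<Sum>j'\<in>set (?js' j). ?term j j')"
    by (simp only: sum.distinct_set_conv_list[symmetric] distinct_filter distinct_upt set_upt)
       (simp add: atLeastLessThanSuc_atLeastAtMost)
  also have "\<dots> = (\<Sum>(j, j')\<in>(SIGMA j:{1..m}. set (?js' j)). ?term j j')"
    by (intro sum.Sigma) auto
  \<comment> \<open>As \<open>j\<close> is at least 1, the subtraction in \<open>j - 1\<close> does
    not truncate, and the three listed positions are those at distance at most 1.\<close>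
  also have "(SIGMA j:{1..m}. set (?js' j))
      = {(j, j'). j \<in> {1..m} \<and> j' \<in> {1..m} \<and> \<bar>int j - int j'\<bar> \<le> 1}"
    by auto
  finally show ?thesis .
qed

lemma value_of_closed_form_arith:
  assumes "finite J" "\<And>i. i \<in> J \<Longrightarrow> subdivision (S i) \<and> card (S i) = m i"
  shows "value_of (assignment S a b) (closed_form_arith J istar m)
    = closed_form J istar m (\<lambda>i. E1 (S i)) (\<lambda>i. E2 (S i)) a b"
proof -
  have sum: "value_of (assignment S a b) (sum_arith (map f (sorted_list_of_set J)))
      = (\<Sum>i\<in>J. value_of (assignment S a b) (f i))" for f
    using assms(1)
    by (simp add: value_of_sum_arith comp_def sum.distinct_set_conv_list[symmetric])
  have "value_of (assignment S a b) (mean_arith (m i) i)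
        = (\<Sum>j=1..m i. (a i j - b i j) * E1 (S i) j)"
      "value_of (assignment S a b) (band_arith (m i) i)
        = (\<Sum>(j, j') | j \<in> {1..m i} \<and> j' \<in> {1..m i} \<and> \<bar>int j - int j'\<bar> \<le> 1.
             (a i j - b i j) * (a i j' - b i j') * E2 (S i) j j')" if "i \<in> J" for i
    using assms(2)[OF that] value_of_mean_arith[of i] value_of_band_arith[of i] by auto
  then show ?thesis
    by (simp add: closed_form_arith_def closed_form_def Let_def sum power2_eq_square)
qed

end

section \<open>The two-knot subdivision of the new variable\<close>

lemma subdivision_0_1: "subdivision {0, 1}"
  by (simp add: subdivision_def)

lemma knot_0_1: "knot {0, 1} 1 = 0" "knot {0, 1} 2 = 1"
  using knot_first[OF subdivision_0_1] knot_last[OF subdivision_0_1] by (simp_all add: numeral_2_eq_2)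

lemma hat_basis_0_1:
  assumes "t \<in> {0..1}"
  shows "hat_basis {0, 1} 1 t = 1 - t" "hat_basis {0, 1} 2 t = t"
  using assms knot_0_1 hat_basis_down[OF subdivision_0_1, of 1 t] hat_basis_up[OF subdivision_0_1, of 2 t]
  by (simp_all add: numeral_2_eq_2)

lemma E1_0_1: "E1 {0, 1} 1 = 1 / 2" "E1 {0, 1} 2 = 1 / 2"
  using E1_eq[OF subdivision_0_1, of 1] E1_eq[OF subdivision_0_1, of 2] knot_0_1 by simp_all

lemma E2_0_1:
  "E2 {0, 1} 1 1 = 1 / 3" "E2 {0, 1} 1 2 = 1 / 6" "E2 {0, 1} 2 1 = 1 / 6" "E2 {0, 1} 2 2 = 1 / 3"
  using E2_eq[OF subdivision_0_1, of 1 1] E2_eq[OF subdivision_0_1, of 1 2]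
    E2_eq[OF subdivision_0_1, of 2 1] E2_eq[OF subdivision_0_1, of 2 2] knot_0_1
  by (simp_all add: numeral_2_eq_2)

section \<open>The squared distance between the two mode functions\<close>

theorem proposition1:
  fixes d n :: nat
    and x :: "nat \<Rightarrow> nat \<Rightarrow> real"
    and y :: "real vec"
    and \<tau>2 :: real
    and k k' :: "nat \<Rightarrow> real \<Rightarrow> real \<Rightarrow> real"
    and \<Lambda> :: "nat \<Rightarrow> real set \<Rightarrow> real mat"
    and l u :: "nat \<Rightarrow> real set \<Rightarrow> ereal vec"
    and J :: "nat set"
    and istar :: nat
    and S :: "nat \<Rightarrow> real set"
  defines "S' \<equiv> S(istar := {0, 1})"
    and "J' \<equiv> insert istar J"
  defines "\<xi> \<equiv> mode_coeff n x y \<tau>2 k \<Lambda> l u J S"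
    and "\<xi>' \<equiv> mode_coeff n x y \<tau>2 k' \<Lambda> l u J' S'"
    and "Y \<equiv> mode_function n x y \<tau>2 k \<Lambda> l u J S"
    and "Y' \<equiv> mode_function n x y \<tau>2 k' \<Lambda> l u J' S'"
  assumes data: "\<And>a i. a \<in> {1..n} \<Longrightarrow> i \<in> {1..d} \<Longrightarrow> x a i \<in> {0..1}"
    and obs: "y \<in> carrier_vec n"
    and noise: "\<tau>2 > 0"
    and J: "J \<subseteq> {1..d}"
    and istar: "istar \<in> {1..d} - J"
    and small: "admissible_model n x \<tau>2 k \<Lambda> l u J S"
    and large: "admissible_model n x \<tau>2 k' \<Lambda> l u J' S'"
  shows
    "(\<forall>t\<in>{0..1}. hat_basis (S' istar) 1 t = 1 - t \<and> hat_basis (S' istar) 2 t = t) \<and>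
     (LINT z:(\<Pi>\<^sub>E i\<in>J'. {0..1})|(\<Pi>\<^sub>M i\<in>J'. lborel). (Y z - Y' z)\<^sup>2)
       = closed_form J istar (\<lambda>i. card (S i)) (\<lambda>i. E1 (S i)) (\<lambda>i. E2 (S i)) \<xi> \<xi>' \<and>
     (\<forall>i\<in>J. let m = card (S i); t = knot (S i) in
        (\<forall>j\<in>{1..m}.
           E1 (S i) j =
             (if j = 1 then t 2 / 2
              else if j = m then (1 - t (m - 1)) / 2
              else (t (j + 1) - t (j - 1)) / 2)) \<and>
        (\<forall>j\<in>{1..m}. \<forall>j'\<in>{1..m}.
           E2 (S i) j j' =
             (if j = j' \<and> j = 1 then (t 2 - t 1) / 3
              else if j = j' \<and> j = m then (t m - t (m - 1)) / 3
              else if j = j' then (t (j + 1) - t (j - 1)) / 3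
              else if j' = j + 1 then (t (j + 1) - t j) / 6
              else if j = j' + 1 then (t j - t (j - 1)) / 6
              else 0)) \<and>
        (\<forall>j\<in>{1..m}. \<forall>j'\<in>{1..m}. \<bar>int j - int j'\<bar> \<ge> 2 \<longrightarrow> E2 (S i) j j' = 0)) \<and>
    \<comment> \<open>linear cost, with one constant for all active sets, subdivisions and coefficients\<close>
     (\<exists>K. \<forall>J istar m. finite J \<and> istar \<notin> J \<and> (\<forall>i\<in>J. 2 \<le> m i) \<longrightarrow>
        (\<exists>e. cost e \<le> K * (\<Sum>i\<in>J. m i) + K \<and>
          (\<forall>S a b. (\<forall>i\<in>J. subdivision (S i) \<and> card (S i) = m i) \<longrightarrow>
             value_of (assignment S a b) e
               = closed_form J istar m (\<lambda>i. E1 (S i)) (\<lambda>i. E2 (S i)) a b)))"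
proof (intro conjI)
  have "finite J"
    using J by (rule finite_subset) simp
  have "istar \<notin> J"
    using istar by simp
  have S: "subdivision (S i)" if "i \<in> J" for i
    using small that by (simp add: admissible_model_def)
  have S': "subdivision (S' i)" if "i \<in> J'" for i
    using S that by (auto simp: S'_def J'_def subdivision_0_1)
  \<comment> \<open>Coefficients of the difference: the smaller model is extended by 0 to the new
    variable, so that both models are expanded over \<open>J'\<close> and \<open>S'\<close>.\<close>
  define c where "c i j = (if i = istar then 0 else \<xi> i j) - \<xi>' i j" for i j
  define g where "g i t = (\<Sum>j=1..card (S' i). c i j * hat_basis (S' i) j t)" for i t
  define \<mu> where "\<mu> i = (\<Sum>j=1..card (S' i). c i j * E1 (S' i) j)" for i
  define v where "v i = (\<Sum>j=1..card (S' i). \<Sum>j'=1..card (S' i). c i j * c i j' * E2 (S' i) j j')" for i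
  have old: "S' i = S i" "c i j = \<xi> i j - \<xi>' i j" if "i \<in> J" for i j
    using that \<open>istar \<notin> J\<close> by (auto simp: S'_def c_def)
  have star: "S' istar = {0, 1}" "card {0, 1 :: real} = 2" "c istar j = - \<xi>' istar j" for j
    by (simp_all add: S'_def c_def)
  have sum_1_2: "(\<Sum>j=1..2. f j) = f 1 + f 2" for f :: "nat \<Rightarrow> real"
    by (simp add: numeral_2_eq_2)
  have Y_diff: "Y z - Y' z = (\<Sum>i\<in>J'. g i (z i))" for z
  proof -
    have "Y z = (\<Sum>i\<in>J. \<Sum>j=1..card (S' i). \<xi> i j * hat_basis (S' i) j (z i))"
      by (simp add: Y_def mode_function_def old flip: \<xi>_def)
    also have "\<dots> = (\<Sum>i\<in>J'. \<Sum>j=1..card (S' i).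
        (if i = istar then 0 else \<xi> i j) * hat_basis (S' i) j (z i))"
      using \<open>finite J\<close> \<open>istar \<notin> J\<close> by (auto simp: J'_def intro!: sum.cong)
    finally show ?thesis
      by (simp add: Y'_def mode_function_def g_def c_def left_diff_distrib sum_subtractf flip: \<xi>'_def)
  qed
  have moments: "(LINT t:{0..1}|lborel. g i t) = \<mu> i" "(LINT t:{0..1}|lborel. (g i t)\<^sup>2) = v i"
    if "i \<in> J'" for i
    unfolding g_def \<mu>_def v_def
    by (fact integral_hat_sum[OF S'[OF that]] integral_hat_sum_squared[OF S'[OF that]])+
  have "(LINT z:(\<Pi>\<^sub>E i\<in>J'. {0..1})|(\<Pi>\<^sub>M i\<in>J'. lborel). (\<Sum>i\<in>J'. g i (z i))\<^sup>2)
      = (\<Sum>i\<in>J'. LINT t:{0..1}|lborel. (g i t)\<^sup>2) - (\<Sum>i\<in>J'. (LINT t:{0..1}|lborel. g i t)\<^sup>2)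
        + (\<Sum>i\<in>J'. LINT t:{0..1}|lborel. g i t)\<^sup>2"
    unfolding g_def
    by (intro integral_unit_box_additive_squared continuous_on_hat_sum S')
       (simp_all add: J'_def \<open>finite J\<close>)
  also have "\<dots> = (\<Sum>i\<in>J'. v i) - (\<Sum>i\<in>J'. (\<mu> i)\<^sup>2) + (\<Sum>i\<in>J'. \<mu> i)\<^sup>2"
    by (simp add: moments cong: sum.cong)
  \<comment> \<open>The new variable is split off, with its second moment and squared mean grouped
    into a variance.\<close>
  also have "\<dots> = (\<Sum>i\<in>J. v i) - (\<Sum>i\<in>J. (\<mu> i)\<^sup>2)
      + (v istar - (\<mu> istar)\<^sup>2) + ((\<Sum>i\<in>J. \<mu> i) + \<mu> istar)\<^sup>2"
    using \<open>finite J\<close> \<open>istar \<notin> J\<close> by (simp add: J'_def add.commute)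
  also have "\<mu> istar = - ((\<xi>' istar 1 + \<xi>' istar 2) / 2)"
    by (simp only: \<mu>_def star sum_1_2 E1_0_1) (simp add: field_simps)
  also have "v istar = ((\<xi>' istar 1)\<^sup>2 + \<xi>' istar 1 * \<xi>' istar 2 + (\<xi>' istar 2)\<^sup>2) / 3"
    by (simp only: v_def star sum_1_2 E2_0_1) (simp add: field_simps power2_eq_square)
  \<comment> \<open>The variance of an affine function on the unit interval is its squared total
    change divided by 12.\<close>
  also have "((\<xi>' istar 1)\<^sup>2 + \<xi>' istar 1 * \<xi>' istar 2 + (\<xi>' istar 2)\<^sup>2) / 3
      - (- ((\<xi>' istar 1 + \<xi>' istar 2) / 2))\<^sup>2 = (\<xi>' istar 2 - \<xi>' istar 1)\<^sup>2 / 12"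
    by (simp add: field_simps power2_eq_square)
  also have "(\<Sum>i\<in>J. v i) = (\<Sum>i\<in>J. \<Sum>(j, j') | j \<in> {1..card (S i)} \<and> j' \<in> {1..card (S i)}
      \<and> \<bar>int j - int j'\<bar> \<le> 1. (\<xi> i j - \<xi>' i j) * (\<xi> i j' - \<xi>' i j') * E2 (S i) j j')"
    unfolding v_def
  proof (intro sum.cong refl)
    fix i assume "i \<in> J"
    then show "(\<Sum>j=1..card (S' i). \<Sum>j'=1..card (S' i). c i j * c i j' * E2 (S' i) j j')
        = (\<Sum>(j, j') | j \<in> {1..card (S i)} \<and> j' \<in> {1..card (S i)} \<and> \<bar>int j - int j'\<bar> \<le> 1.
             (\<xi> i j - \<xi>' i j) * (\<xi> i j' - \<xi>' i j') * E2 (S i) j j')"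
      using E2_band_sum[OF S, of i "c i"] by (simp only: old)
  qed
  also have "(\<Sum>i\<in>J. \<mu> i) = (\<Sum>i\<in>J. \<Sum>j=1..card (S i). (\<xi> i j - \<xi>' i j) * E1 (S i) j)"
    by (simp add: \<mu>_def old)
  also have "(\<Sum>i\<in>J. (\<mu> i)\<^sup>2) = (\<Sum>i\<in>J. (\<Sum>j=1..card (S i). (\<xi> i j - \<xi>' i j) * E1 (S i) j)\<^sup>2)"
    by (simp add: \<mu>_def old)
  finally show "(LINT z:(\<Pi>\<^sub>E i\<in>J'. {0..1})|(\<Pi>\<^sub>M i\<in>J'. lborel). (Y z - Y' z)\<^sup>2)
      = closed_form J istar (\<lambda>i. card (S i)) (\<lambda>i. E1 (S i)) (\<lambda>i. E2 (S i)) \<xi> \<xi>'"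
    by (simp only: Y_diff closed_form_def Let_def add_uminus_conv_diff)
  show "\<forall>t\<in>{0..1}. hat_basis (S' istar) 1 t = 1 - t \<and> hat_basis (S' istar) 2 t = t"
    using hat_basis_0_1 by (simp add: S'_def)
  show "\<forall>i\<in>J. let m = card (S i); t = knot (S i) in
        (\<forall>j\<in>{1..m}.
           E1 (S i) j =
             (if j = 1 then t 2 / 2
              else if j = m then (1 - t (m - 1)) / 2
              else (t (j + 1) - t (j - 1)) / 2)) \<and>
        (\<forall>j\<in>{1..m}. \<forall>j'\<in>{1..m}.
           E2 (S i) j j' =
             (if j = j' \<and> j = 1 then (t 2 - t 1) / 3
              else if j = j' \<and> j = m then (t m - t (m - 1)) / 3
              else if j = j' then (t (j + 1) - t (j - 1)) / 3
              else if j' = j + 1 then (t (j + 1) - t j) / 6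
              else if j = j' + 1 then (t j - t (j - 1)) / 6
              else 0)) \<and>
        (\<forall>j\<in>{1..m}. \<forall>j'\<in>{1..m}. \<bar>int j - int j'\<bar> \<ge> 2 \<longrightarrow> E2 (S i) j j' = 0)"
    unfolding Let_def
  proof (intro ballI conjI impI)
    fix i j j'
    assume "i \<in> J" "j \<in> {1..card (S i)}" "j' \<in> {1..card (S i)}" "\<bar>int j - int j'\<bar> \<ge> 2"
    then show "E2 (S i) j j' = 0"
      using E2_eq[OF S, of i j j'] by auto
  qed (use E1_eq[OF S] E2_eq[OF S] in blast)+
  show "\<exists>K. \<forall>J istar m. finite J \<and> istar \<notin> J \<and> (\<forall>i\<in>J. 2 \<le> m i) \<longrightarrow>
        (\<exists>e. cost e \<le> K * (\<Sum>i\<in>J. m i) + K \<and>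
          (\<forall>S a b. (\<forall>i\<in>J. subdivision (S i) \<and> card (S i) = m i) \<longrightarrow>
             value_of (assignment S a b) e
               = closed_form J istar m (\<lambda>i. E1 (S i)) (\<lambda>i. E2 (S i)) a b))"
  \<comment> \<open>The constant is that of the cost bound. The witness depends on \<open>J\<close>,
    \<open>istar\<close> and \<open>m\<close> only, so one formula serves all subdivisions with
    these numbers of knots and all coefficients.\<close>
  proof (intro exI[of _ 94] allI impI)
    fix J :: "nat set" and istar :: nat and m :: "nat \<Rightarrow> nat"
    assume "finite J \<and> istar \<notin> J \<and> (\<forall>i\<in>J. 2 \<le> m i)"
    then show "\<exists>e. cost e \<le> 94 * (\<Sum>i\<in>J. m i) + 94 \<and>
        (\<forall>S a b. (\<forall>i\<in>J. subdivision (S i) \<and> card (S i) = m i) \<longrightarrow>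
           value_of (assignment S a b) e
             = closed_form J istar m (\<lambda>i. E1 (S i)) (\<lambda>i. E2 (S i)) a b)"
      by (intro exI[of _ "closed_form_arith J istar m"] conjI allI impI
            cost_closed_form_arith value_of_closed_form_arith) auto
  qed
qed

end
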